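(* For each integer $t\ge 1$ let $M_{\mathrm a}(t)$ be the number of $3\times 3$ magic squares with magic sum $t$. Then $$\sum_{t>0} M_{\mathrm a}(t)\,x^t=\frac{8x^{15}(2x^3+1)}{(1-x^3)(1-x^6)(1-x^9)},$$ and for every integer $t\ge 1$ $$M_{\mathrm a}(t)=\begin{cases} \frac{2t^2-32t+144}{9}, & t\equiv 0 \pmod{18},\\[2pt] \frac{2t^2-32t+78}{9}, & t\equiv 3 \pmod{18},\\[2pt] \frac{2t^2-32t+120}{9}, & t\equiv 6 \pmod{18},\\[2pt] \frac{2t^2-32t+126}{9}, & t\equiv 9 \pmod{18},\\[2pt] \frac{2t^2-32t+96}{9}, & t\equiv 12 \pmod{18},\\[2pt] \frac{2t^2-32t+102}{9}, & t\equiv 15 \pmod{18},\\[2pt] 0, & t\not\equiv 0 \pmod 3. \end{cases}$$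
   Context: A $3\times3$ magic square (in the strong sense) is a $3\times 3$ matrix of pairwise distinct positive integers in which all three row sums, all three column sums and both diagonal sums are equal; the common value is the magic sum. Squares are counted as matrices (not up to symmetry). *)

theory Defs
  imports "HOL-Analysis.Analysis" "HOL-Computational_Algebra.Formal_Power_Series"
begin

(* An element of the type 3 is one of the indices 1, 2 and 3 (arithmetic is modulo 3, so 3 = 0). *)
definition magic_square :: "int ^ 3 ^ 3 \<Rightarrow> int \<Rightarrow> bool" where
  "magic_square A s \<longleftrightarrow>
     (\<forall>i j. A $ i $ j > 0) \<and>
     inj (\<lambda>(i, j). A $ i $ j) \<and>
     (\<forall>i. (\<Sum>j\<in>UNIV. A $ i $ j) = s) \<and>
     (\<forall>j. (\<Sum>i\<in>UNIV. A $ i $ j) = s) \<and>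
     A $ 1 $ 1 + A $ 2 $ 2 + A $ 3 $ 3 = s \<and>
     A $ 1 $ 3 + A $ 2 $ 2 + A $ 3 $ 1 = s"

definition M_a :: "nat \<Rightarrow> nat" where
  "M_a t = card {A. magic_square A (int t)}"

lemma finite_vec_set:
  fixes S :: "'a set"
  assumes "finite S"
  shows "finite {v :: 'a ^ 'n. \<forall>j. v $ j \<in> S}"
proof -
  have "finite (PiE (UNIV :: 'n set) (\<lambda>_. S))"
    using assms by (intro finite_PiE) auto
  moreover have "{v :: 'a ^ 'n. \<forall>j. v $ j \<in> S} \<subseteq> vec_lambda ` PiE UNIV (\<lambda>_. S)"
  proof
    fix v :: "'a ^ 'n"
    assume "v \<in> {v. \<forall>j. v $ j \<in> S}"
    then have "vec_nth v \<in> PiE UNIV (\<lambda>_. S)" by auto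
    then show "v \<in> vec_lambda ` PiE UNIV (\<lambda>_. S)"
      by (intro image_eqI[of _ _ "vec_nth v"]) simp_all
  qed
  ultimately show ?thesis
    by (meson finite_imageI finite_subset)
qed

lemma finite_magic_squares: "finite {A. magic_square A s}"
proof -
  have "{A. magic_square A s} \<subseteq>
      {A. \<forall>i. A $ i \<in> {v. \<forall>j. v $ j \<in> {0..s}}}"
  proof clarify
    fix A :: "int ^ 3 ^ 3" and i j :: 3
    assume A: "magic_square A s"
    then have pos: "\<And>i j. 0 \<le> A $ i $ j" and row: "(\<Sum>j\<in>UNIV. A $ i $ j) = s"
      by (auto simp: magic_square_def less_imp_le)
    have "A $ i $ j \<le> (\<Sum>j\<in>UNIV. A $ i $ j)"
      by (rule member_le_sum) (auto simp: pos)
    with pos row show "A $ i $ j \<in> {0..s}" by simp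
  qed
  moreover have "finite {A :: int ^ 3 ^ 3. \<forall>i. A $ i \<in> {v. \<forall>j. v $ j \<in> {0..s}}}"
    by (intro finite_vec_set) simp
  ultimately show ?thesis
    by (rule finite_subset)
qed

end

(* A square with magic sum t = 3 c has centre c, and by Lucas its entries are c together with
   c +- a, c +- b, c +- (a + b), c +- (a - b).  Positivity becomes |a| + |b| < c and distinctness
   excludes the lines a = 0, b = 0, |a| = |b|, |a| = 2 |b|, |b| = 2 |a|.  Up to the four choices of
   signs one counts the positive pairs with a + b <= n = c - 1 off three lines:
   n (n - 1) / 2 - floor (n / 2) - 2 floor (n / 3).
   The generating function then amounts to a linear recurrence for these numbers. *)
theory Submission
  imports Defs
begin

section \<open>Lucas parametrisation of the squares with a given centre\<close>

definition lucas_square :: "int \<Rightarrow> int \<Rightarrow> int \<Rightarrow> int ^ 3 ^ 3" where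
  "lucas_square c a b = vector [vector [c + a, c - a - b, c + b],
                                vector [c - a + b, c, c + a - b],
                                vector [c - b, c + a + b, c - a]]"

definition admissible :: "int \<Rightarrow> (int \<times> int) set" where
  "admissible n = {(a, b). a \<noteq> 0 \<and> b \<noteq> 0 \<and> \<bar>a\<bar> + \<bar>b\<bar> \<le> n \<and>
                       \<bar>a\<bar> \<noteq> \<bar>b\<bar> \<and> \<bar>a\<bar> \<noteq> 2 * \<bar>b\<bar> \<and> \<bar>b\<bar> \<noteq> 2 * \<bar>a\<bar>}"

text \<open>The middle column and the two diagonals together cover the top and bottom rows once and
  the centre three times, so \<open>3 * s = 2 * s + 3 * A $ 2 $ 2\<close>. The centre and the two
  upper corners then determine the other entries linearly.\<close>

lemma magic_square_eq_lucas_square: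
  assumes "magic_square A s"
  shows "s = 3 * A $ 2 $ 2"
    and "A = lucas_square (A $ 2 $ 2) (A $ 1 $ 1 - A $ 2 $ 2) (A $ 1 $ 3 - A $ 2 $ 2)"
  using assms unfolding magic_square_def lucas_square_def
  by (simp_all add: vec_eq_iff forall_3 sum_3 vector_3)

text \<open>The line sums hold identically in \<open>a\<close>, \<open>b\<close>, so only positivity
  and distinctness remain. The smallest entry is \<open>c - \<bar>a\<bar> - \<bar>b\<bar>\<close>. A
  difference of two entries is, up to sign, one of a, b, a + b, a - b, or twice one of these, or 2a
  + b, 2a - b, a + 2b, a - 2b.\<close>

lemma magic_lucas_square_iff:
  "magic_square (lucas_square c a b) (3 * c) \<longleftrightarrow> (a, b) \<in> admissible (c - 1)"
proof -
  \<comment> \<open>In this curried form \<open>forall_3\<close> can expand injectivity into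
    comparisons of concrete entries.\<close>
  have *: "inj (\<lambda>(i, j). A $ i $ j) \<longleftrightarrow>
      (\<forall>i j k l. A $ i $ j = A $ k $ l \<longrightarrow> i = k \<and> j = l)" for A :: "int ^ 3 ^ 3"
    by (auto simp: inj_def)
  have **: "magic_square (lucas_square c a b) (3 * c) \<longleftrightarrow>
      (\<forall>i j. lucas_square c a b $ i $ j > 0) \<and> inj (\<lambda>(i, j). lucas_square c a b $ i $ j)"
    by (auto simp: magic_square_def lucas_square_def forall_3 sum_3 vector_3)
  have pos: "(\<forall>i j. lucas_square c a b $ i $ j > 0) \<longleftrightarrow> c > 0 \<and> \<bar>a\<bar> + \<bar>b\<bar> \<le> c - 1"
    unfolding lucas_square_def forall_3 vector_3 by simp arith
  have inj: "inj (\<lambda>(i, j). lucas_square c a b $ i $ j) \<longleftrightarrow>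
      a \<noteq> 0 \<and> b \<noteq> 0 \<and> a \<noteq> b \<and> a \<noteq> - b \<and> a \<noteq> 2 * b \<and> a \<noteq> - 2 * b \<and> b \<noteq> 2 * a \<and> b \<noteq> - 2 * a"
    unfolding * lucas_square_def forall_3 vector_3 by (simp; safe; simp)
  show ?thesis
    unfolding ** pos inj admissible_def by (simp; safe; simp)
qed

text \<open>The inverse map reads \<open>a\<close> and \<open>b\<close> off the upper corners. The
  subtraction is in \<open>int\<close>, so \<open>c = 0\<close> gives
  \<open>admissible (- 1)\<close>, which is empty.\<close>

lemma M_a_eq_card_admissible: "M_a (3 * c) = card (admissible (int c - 1))"
proof -
  have "bij_betw (\<lambda>(a, b). lucas_square (int c) a b) (admissible (int c - 1))
          {A. magic_square A (int (3 * c))}"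
  proof (rule bij_betwI[where g = "\<lambda>A. (A $ 1 $ 1 - int c, A $ 1 $ 3 - int c)"])
    show "(\<lambda>(a, b). lucas_square (int c) a b) \<in>
        admissible (int c - 1) \<rightarrow> {A. magic_square A (int (3 * c))}"
      by (auto simp: magic_lucas_square_iff)
  next
    have *: "A = lucas_square (int c) (A $ 1 $ 1 - int c) (A $ 1 $ 3 - int c)"
      if "magic_square A (int (3 * c))" for A
      using magic_square_eq_lucas_square[OF that] by simp
    then show "(\<lambda>A. (A $ 1 $ 1 - int c, A $ 1 $ 3 - int c)) \<in>
        {A. magic_square A (int (3 * c))} \<rightarrow> admissible (int c - 1)"
      by (auto simp flip: magic_lucas_square_iff)
    show "(case (A $ 1 $ 1 - int c, A $ 1 $ 3 - int c) of (a, b) \<Rightarrow> lucas_square (int c) a b) = A"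
      if "A \<in> {A. magic_square A (int (3 * c))}" for A
      using *[of A] that by simp
  qed (auto simp: lucas_square_def vector_3)
  then show ?thesis
    by (simp add: M_a_def bij_betw_same_card)
qed

lemma M_a_not_dvd: "\<not> 3 dvd t \<Longrightarrow> M_a t = 0"
proof -
  assume "\<not> 3 dvd t"
  then have "\<not> magic_square A (int t)" for A
    using magic_square_eq_lucas_square(1)[of A "int t"] by (auto; presburger)
  then show ?thesis by (simp add: M_a_def)
qed

section \<open>Counting admissible pairs, and a recurrence for the counts\<close>

definition pos_admissible :: "nat \<Rightarrow> (nat \<times> nat) set" where
  "pos_admissible n = {(a, b). a > 0 \<and> b > 0 \<and> a + b \<le> n \<and> a \<noteq> b \<and> a \<noteq> 2 * b \<and> b \<noteq> 2 * a}"

lemma card_pos_pairs_sum_le: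
  "2 * card {(a, b). a > 0 \<and> b > 0 \<and> a + b \<le> (n::nat)} = n * (n - 1)"
proof -
  have "{(a, b). a > 0 \<and> b > 0 \<and> a + b \<le> n} = (SIGMA a:{1..n}. {1..n - a})"
    by auto
  then have "card {(a, b). a > 0 \<and> b > 0 \<and> a + b \<le> n} = (\<Sum>a=1..n. n - a)"
    by simp
  \<comment> \<open>Reversing the order of summation gives the Gauss sum.\<close>
  also have "\<dots> = \<Sum>{0..<n}"
    by (rule sum.reindex_bij_witness[where i = "\<lambda>k. n - k" and j = "\<lambda>k. n - k"]) auto
  finally show ?thesis
    using gauss_sum_nat[of "n - 1"]
    by (cases n) (auto simp: atLeastLessThanSuc_atLeastAtMost)
qed

lemma finite_pos_pairs_sum_le: "finite {(a, b). a > 0 \<and> b > 0 \<and> a + b \<le> (n::nat)}"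
  by (rule finite_subset[of _ "{..n} \<times> {..n}"]) auto

text \<open>The three excluded lines meet only at the origin, so their positive parts are disjoint:
  \<open>(a, a)\<close> needs \<open>2 * a \<le> n\<close>, while \<open>(a, 2 * a)\<close> and
  \<open>(2 * a, a)\<close> need \<open>3 * a \<le> n\<close>.\<close>

lemma card_pos_admissible:
  "2 * card (pos_admissible n) + 2 * (n div 2) + 4 * (n div 3) = n * (n - 1)"
proof -
  let ?D = "(\<lambda>a. (a, a)) ` {1..n div 2}"
  let ?E = "(\<lambda>a. (a, 2 * a)) ` {1..n div 3}"
  let ?F = "(\<lambda>a. (2 * a, a)) ` {1..n div 3}"
  have eq: "{(a, b). a > 0 \<and> b > 0 \<and> a + b \<le> n} = pos_admissible n \<union> (?D \<union> (?E \<union> ?F))"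
    unfolding pos_admissible_def by (auto simp: image_iff)
  have "finite (pos_admissible n)"
    using finite_pos_pairs_sum_le[of n] unfolding eq by simp
  then have "card {(a, b). a > 0 \<and> b > 0 \<and> a + b \<le> n} =
      card (pos_admissible n) + (card ?D + (card ?E + card ?F))"
    unfolding eq by (subst card_Un_disjoint; (subst card_Un_disjoint)?; (subst card_Un_disjoint)?;
      force simp: pos_admissible_def)
  moreover have "card ?D = n div 2" "card ?E = n div 3" "card ?F = n div 3"
    by (subst card_image; simp add: inj_on_def)+
  ultimately show ?thesis
    using card_pos_pairs_sum_le[of n] by simp
qed

text \<open>The conditions depend only on absolute values and exclude zero coordinates, so each
  positive pair has exactly four signed versions.\<close>

lemma card_admissible: "card (admissible (int n)) = 4 * card (pos_admissible n)"
proof -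
  have "bij_betw (\<lambda>((s, t), (a, b)). (s * int a, t * int b))
     (({-1, 1} \<times> {-1, 1}) \<times> pos_admissible n) (admissible (int n))"
  proof (rule bij_betwI[where g = "\<lambda>(a, b). ((sgn a, sgn b), (nat \<bar>a\<bar>, nat \<bar>b\<bar>))"], goal_cases)
    case 1
    show ?case by (auto simp: admissible_def pos_admissible_def)
  next
    case 2
    have "((sgn a, sgn b), (nat \<bar>a\<bar>, nat \<bar>b\<bar>)) \<in> ({- 1, 1} \<times> {- 1, 1}) \<times> pos_admissible n"
      if ab: "(a, b) \<in> admissible (int n)" for a b
    proof -
      obtain p q where pq: "\<bar>a\<bar> = int p" "\<bar>b\<bar> = int q"
        by (metis abs_ge_zero nonneg_int_cases)
      have nz: "a \<noteq> 0" "b \<noteq> 0"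
        using ab by (simp_all add: admissible_def)
      then have "p > 0" "q > 0"
        using pq by auto
      then have "(p, q) \<in> pos_admissible n"
        using ab by (auto simp: admissible_def pos_admissible_def pq)
      then show ?thesis
        using nz by (simp add: pq sgn_if)
    qed
    then show ?case by auto
  next
    case (3 x)
    then show ?case by (auto simp: pos_admissible_def)
  next
    case (4 y)
    show ?case by (cases y) (simp add: sgn_mult_abs)
  qed
  from bij_betw_same_card[OF this] show ?thesis
    by (simp add: card_cartesian_product)
qed

text \<open>Nine times the number of squares with centre \<open>c\<close>: multiplying by 9 and writing
  \<open>n div 2\<close>, \<open>n div 3\<close> through \<open>n mod 2\<close>, \<open>n mod 3\<close> (where \<open>n = c - 1\<close>) avoids fractions.\<close>

definition magic_count9 :: "int \<Rightarrow> int" where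
  "magic_count9 c = (if c > 0 then 18 * (c - 1)\<^sup>2 - 60 * (c - 1) +
     18 * ((c - 1) mod 2) + 24 * ((c - 1) mod 3) else 0)"

text \<open>Replacing the quotients by remainders adds 18 and 24 to the linear coefficient 18 coming
  from \<open>n * (n - 1)\<close>, which makes 60.\<close>

lemma M_a_mult_3:
  assumes "c > 0"
  shows "9 * int (M_a (3 * c)) = magic_count9 (int c)"
proof -
  from assms obtain n where n: "c = Suc n" by (cases c) auto
  have "int (2 * card (pos_admissible n) + 2 * (n div 2) + 4 * (n div 3)) = int (n * (n - 1))"
    by (simp only: card_pos_admissible)
  also have "\<dots> = (int n)\<^sup>2 - int n"
    by (cases n) (simp_all add: algebra_simps power2_eq_square)
  finally have "2 * int (card (pos_admissible n)) + 2 * (int n div 2) + 4 * (int n div 3) = (int n)\<^sup>2 - int n"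
    by (simp add: zdiv_int)
  moreover have "int (M_a (3 * c)) = 4 * int (card (pos_admissible n))"
    using M_a_eq_card_admissible[of c] card_admissible[of n] by (simp add: n)
  moreover have "magic_count9 (int c) = 18 * (int n)\<^sup>2 - 60 * int n + 18 * (int n mod 2) + 24 * (int n mod 3)"
    by (simp add: n magic_count9_def)
  moreover have "int n mod 2 = int n - 2 * (int n div 2)" "int n mod 3 = int n - 3 * (int n div 3)"
    by (simp_all add: minus_mult_div_eq_mod)
  ultimately show ?thesis
    by (simp only:) simp
qed

text \<open>The coefficients are those of \<open>(1 - y) (1 - y^2) (1 - y^3) = 1 - y - y^2 + y^4 + y^5 - y^6\<close>.\<close>

lemma magic_count9_recurrence:
  "magic_count9 c - magic_count9 (c - 1) - magic_count9 (c - 2) + magic_count9 (c - 4)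
     + magic_count9 (c - 5) - magic_count9 (c - 6) = (if c = 5 then 72 else if c = 6 then 144 else 0)"
proof -
  consider "c \<le> 0" | "c \<in> {1..6}" | "c > 6"
    by fastforce
  then show ?thesis
  proof cases
    case 1
    then show ?thesis by (simp add: magic_count9_def)
  next
    case 2
    \<comment> \<open>The first nonzero values are 72 at 5 and 216 at 6, whence 72 and 216 - 72 =
      144 on the right.\<close>
    then show ?thesis by (auto simp: simp_from_to magic_count9_def)
  next
    case c: 3
    \<comment> \<open>All six arguments are now positive, so the quadratic formula applies to each.
      The index \<open>j = k + 1\<close> absorbs the shift \<open>c - 1\<close>. The periodic terms
      cancel by their periods 2 and 3, the polynomial ones by direct expansion.\<close>
    define d e where "d k = (c - k) mod 2" and "e k = (c - k) mod 3" for k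
    have val: "magic_count9 (c - k) = 18 * (c - j)\<^sup>2 - 60 * (c - j) + 18 * d j + 24 * e j"
      if "k < c" "j = k + 1" for k j
      using that by (simp add: magic_count9_def d_def e_def diff_diff_eq)
    have "d 3 = d 1" "d 5 = d 1" "d 7 = d 1" "d 6 = d 2" "e 7 = e 1" "e 5 = e 2" "e 6 = e 3"
      unfolding d_def e_def by presburger+
    moreover have "(c - 1)\<^sup>2 - (c - 2)\<^sup>2 - (c - 3)\<^sup>2 + (c - 5)\<^sup>2 + (c - 6)\<^sup>2 - (c - 7)\<^sup>2 = 0"
      by (simp add: power2_eq_square algebra_simps)
    moreover have "magic_count9 c = 18 * (c - 1)\<^sup>2 - 60 * (c - 1) + 18 * d 1 + 24 * e 1"
      using val[of 0 1] c by simp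
    moreover note val[of 1 2] val[of 2 3] val[of 4 5] val[of 5 6] val[of 6 7]
    ultimately show ?thesis
      using c by simp
  qed
qed

section \<open>Generating function and closed form\<close>

lemma M_a_genfun_nth:
  "fps_nth (Abs_fps (\<lambda>t. if t > 0 then of_nat (M_a t) else 0) :: rat fps) n =
     (if 3 dvd n then of_int (magic_count9 (int n div 3)) / 9 else 0)"
proof (cases "3 dvd n")
  case True
  then obtain c where c: "n = 3 * c" ..
  show ?thesis
  proof (cases "c = 0")
    case False
    then have "9 * (of_nat (M_a n) :: rat) = of_int (magic_count9 (int c))"
      using arg_cong[OF M_a_mult_3[of c], of "of_int :: int \<Rightarrow> rat"] by (simp add: c)
    with False show ?thesis by (simp add: c)
  \<comment> \<open>At index 0 the series has coefficient 0 by definition, in agreement with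
    \<open>magic_count9 0 = 0\<close>.\<close>
  qed (simp add: c magic_count9_def)
qed (simp add: M_a_not_dvd)

text \<open>After clearing the denominator, coefficients are compared: multiplying by
  \<open>fps_X ^ (3 * k)\<close> shifts \<open>magic_count9\<close> by \<open>k\<close>, and the
  values 72 and 144 of the recurrence, divided by 9, are the coefficients 8 and 16 of the
  numerator.\<close>

lemma M_a_genfun:
  "(Abs_fps (\<lambda>t. if t > 0 then of_nat (M_a t) else 0) :: rat fps) =
     8 * fps_X ^ 15 * (2 * fps_X ^ 3 + 1) / ((1 - fps_X ^ 3) * (1 - fps_X ^ 6) * (1 - fps_X ^ 9))"
  (is "?F = ?N / ?D")
proof -
  have D: "?F * ?D = ?F - ?F * fps_X ^ 3 - ?F * fps_X ^ 6 + ?F * fps_X ^ 12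
      + ?F * fps_X ^ 15 - ?F * fps_X ^ 18"
    by (simp add: algebra_simps flip: power_add)
  have N: "?N = fps_const 8 * fps_X ^ 15 + fps_const 16 * fps_X ^ 18"
    by (simp add: algebra_simps numeral_fps_const flip: power_add)
  have nth: "fps_nth (?F * fps_X ^ (3 * k)) n =
      (if 3 dvd n then of_int (magic_count9 (int n div 3 - int k)) / 9 else 0)" for k n
  proof (cases "n < 3 * k")
    case True
    \<comment> \<open>The argument of \<open>magic_count9\<close> is negative here, so its value 0
      matches the vanishing coefficient.\<close>
    then show ?thesis by (auto simp: fps_X_power_mult_right_nth magic_count9_def)
  next
    case False
    then have "int (n - 3 * k) div 3 = int n div 3 - int k" "3 dvd n - 3 * k \<longleftrightarrow> 3 dvd n"
      by presburger+
    with False show ?thesis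
      by (simp only: fps_X_power_mult_right_nth M_a_genfun_nth if_False)
  qed
  have eq: "?F * ?D = ?N"
  proof (rule fps_ext)
    fix n
    have "fps_nth (?F * ?D) n = (if 3 dvd n then of_int (let c = int n div 3 in
        magic_count9 c - magic_count9 (c - 1) - magic_count9 (c - 2) + magic_count9 (c - 4)
        + magic_count9 (c - 5) - magic_count9 (c - 6)) / 9 else 0)"
      unfolding D using nth[of 0 n] nth[of 1 n] nth[of 2 n] nth[of 4 n] nth[of 5 n] nth[of 6 n]
      by (simp add: Let_def add_divide_distrib diff_divide_distrib)
    also have "\<dots> = fps_nth ?N n"
      unfolding N Let_def magic_count9_recurrence by (auto simp: fps_X_power_nth)
    finally show "fps_nth (?F * ?D) n = fps_nth ?N n" .
  qed
  have "?D \<noteq> 0"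
  proof
    assume "?D = 0"
    then have "fps_nth ?D 0 = 0" by (simp only: fps_zero_nth)
    then show False by simp
  qed
  then show ?thesis
    unfolding eq[symmetric] by (rule nonzero_mult_div_cancel_right[symmetric])
qed

text \<open>Here \<open>t div 3 + 1\<close> and \<open>t div 3 + 2\<close> represent \<open>t div 3 - 1\<close> modulo 2 and 3
  without truncated subtraction.\<close>

lemma M_a_closed_form:
  assumes "t > 0" "3 dvd t"
  shows "(of_nat (M_a t) :: rat) = (2 * (of_nat t)^2 - 32 * of_nat t + 78
      + of_nat (18 * ((t div 3 + 1) mod 2) + 24 * ((t div 3 + 2) mod 3))) / 9"
proof -
  obtain n where t: "t = 3 * Suc n"
    using assms by (elim dvdE) (metis Suc_pred mult_is_0 neq0_conv)
  \<comment> \<open>Since n = t/3 - 1, the expression 18 n^2 - 60 n becomes 2 t^2 - 32 t +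
    78.\<close>
  have "9 * int (M_a t) = 2 * (int t)\<^sup>2 - 32 * int t + 78 + int (18 * (n mod 2) + 24 * (n mod 3))"
    using M_a_mult_3[of "Suc n"]
    by (simp add: t magic_count9_def power2_eq_square algebra_simps zmod_int)
  moreover have "(t div 3 + 1) mod 2 = n mod 2" "(t div 3 + 2) mod 3 = n mod 3"
    unfolding t by presburger+
  ultimately have "(of_int (9 * int (M_a t)) :: rat) = of_int (2 * (int t)\<^sup>2 - 32 * int t + 78
      + int (18 * ((t div 3 + 1) mod 2) + 24 * ((t div 3 + 2) mod 3)))"
    by simp
  then show ?thesis by simp
qed

theorem mainTheorem2:
  shows "(Abs_fps (\<lambda>t. if t > 0 then of_nat (M_a t) else 0) :: rat fps) =
           8 * fps_X ^ 15 * (2 * fps_X ^ 3 + 1) /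
             ((1 - fps_X ^ 3) * (1 - fps_X ^ 6) * (1 - fps_X ^ 9)) \<and>
         (\<forall>t::nat. t \<ge> 1 \<longrightarrow>
           (t mod 18 = 0 \<longrightarrow> (of_nat (M_a t) :: rat) = (2 * (of_nat t)^2 - 32 * of_nat t + 144) / 9) \<and>
           (t mod 18 = 3 \<longrightarrow> (of_nat (M_a t) :: rat) = (2 * (of_nat t)^2 - 32 * of_nat t + 78) / 9) \<and>
           (t mod 18 = 6 \<longrightarrow> (of_nat (M_a t) :: rat) = (2 * (of_nat t)^2 - 32 * of_nat t + 120) / 9) \<and>
           (t mod 18 = 9 \<longrightarrow> (of_nat (M_a t) :: rat) = (2 * (of_nat t)^2 - 32 * of_nat t + 126) / 9) \<and>
           (t mod 18 = 12 \<longrightarrow> (of_nat (M_a t) :: rat) = (2 * (of_nat t)^2 - 32 * of_nat t + 96) / 9) \<and>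
           (t mod 18 = 15 \<longrightarrow> (of_nat (M_a t) :: rat) = (2 * (of_nat t)^2 - 32 * of_nat t + 102) / 9) \<and>
           (t mod 3 \<noteq> 0 \<longrightarrow> M_a t = 0))"
proof (intro conjI allI impI)
  fix t :: nat
  assume "t mod 3 \<noteq> 0"
  then show "M_a t = 0" by (intro M_a_not_dvd) presburger
next
  fix t :: nat
  assume t: "t \<ge> 1" "t mod 18 = 0"
  \<comment> \<open>The class modulo 18 fixes both remainders, and the constant is 78 plus 18 times
    the first plus 24 times the second: here 78 + 18 + 48 = 144. The other classes are
    analogous.\<close>
  then have "3 dvd t" "(t div 3 + 1) mod 2 = 1" "(t div 3 + 2) mod 3 = 2" by presburger+
  with t show "(of_nat (M_a t) :: rat) = (2 * (of_nat t)^2 - 32 * of_nat t + 144) / 9"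
    by (simp add: M_a_closed_form)
next
  fix t :: nat
  assume t: "t \<ge> 1" "t mod 18 = 3"
  then have "3 dvd t" "(t div 3 + 1) mod 2 = 0" "(t div 3 + 2) mod 3 = 0" by presburger+
  with t show "(of_nat (M_a t) :: rat) = (2 * (of_nat t)^2 - 32 * of_nat t + 78) / 9"
    by (simp add: M_a_closed_form)
next
  fix t :: nat
  assume t: "t \<ge> 1" "t mod 18 = 6"
  then have "3 dvd t" "(t div 3 + 1) mod 2 = 1" "(t div 3 + 2) mod 3 = 1" by presburger+
  with t show "(of_nat (M_a t) :: rat) = (2 * (of_nat t)^2 - 32 * of_nat t + 120) / 9"
    by (simp add: M_a_closed_form)
next
  fix t :: nat
  assume t: "t \<ge> 1" "t mod 18 = 9"
  then have "3 dvd t" "(t div 3 + 1) mod 2 = 0" "(t div 3 + 2) mod 3 = 2" by presburger+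
  with t show "(of_nat (M_a t) :: rat) = (2 * (of_nat t)^2 - 32 * of_nat t + 126) / 9"
    by (simp add: M_a_closed_form)
next
  fix t :: nat
  assume t: "t \<ge> 1" "t mod 18 = 12"
  then have "3 dvd t" "(t div 3 + 1) mod 2 = 1" "(t div 3 + 2) mod 3 = 0" by presburger+
  with t show "(of_nat (M_a t) :: rat) = (2 * (of_nat t)^2 - 32 * of_nat t + 96) / 9"
    by (simp add: M_a_closed_form)
next
  fix t :: nat
  assume t: "t \<ge> 1" "t mod 18 = 15"
  then have "3 dvd t" "(t div 3 + 1) mod 2 = 0" "(t div 3 + 2) mod 3 = 1" by presburger+
  with t show "(of_nat (M_a t) :: rat) = (2 * (of_nat t)^2 - 32 * of_nat t + 102) / 9"
    by (simp add: M_a_closed_form)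
qed (rule M_a_genfun)

end
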